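(* Let $a,b\in\mathbb{N}$ with $a\geq 3$, $b\geq 4$ and $a\leq b$. Then there is a matrix $M\in\mathcal{M}(K_{a,b})$ with $\operatorname{corank}(M)=4$ that does not satisfy the Strong Arnold Property (SAP).
   Context: $K_{a,b}$ is the complete bipartite graph with parts of sizes $a$ and $b$. For a finite simple undirected graph $G=(V,E)$, $\mathcal{M}(G)$ denotes the set of all real symmetric matrices $M\in\mathbb{R}^{V\times V}$ such that (i) $M_{uv}<0$ whenever $uv\in E$, and $M_{uv}=0$ whenever $uv\notin E$ and $u\neq v$; (ii) $M$ has exactly one negative eigenvalue (counted with multiplicity). There is no condition on the diagonal of $M$. $\operatorname{corank}(M)=\dim\ker(M)$. A matrix $M\in\mathcal{M}(G)$ satisfies the Strong Arnold Property (SAP) if there is no non-zero symmetric matrix $X\in\mathbb{R}^{V\times V}$ such that $MX=\mathbf{0}$ and $X_{uv}=0$ whenever $uv\in E$ or $u=v$. *)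

theory Defs
  imports
    "Graph_Theory.Kuratowski"
    "Jordan_Normal_Form.Char_Poly"
    "Jordan_Normal_Form.Matrix_Kernel"
begin

text \<open>
  A finite simple undirected graph is a \<^locale>\<open>pair_graph\<close>: a finite loop-free digraph whose arc
  set is symmetric. Matrices of type \<^typ>\<open>real mat\<close> are indexed by initial segments of the
  naturals, so a matrix in $R^{V \times V}$ presupposes \<open>V = {..<n}\<close>.
\<close>

definition complete_bipartite_graph :: "nat \<Rightarrow> nat \<Rightarrow> nat pair_pre_digraph" where
  "complete_bipartite_graph a b =
     \<lparr> pverts = {..<a + b},
       parcs = {..<a} \<times> {a..<a + b} \<union> {a..<a + b} \<times> {..<a} \<rparr>"

lemma complete_bipartite_graph: "K\<^bsub>a,b\<^esub> (with_proj (complete_bipartite_graph a b))"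
  unfolding complete_bipartite_digraph_pair_def
proof (intro conjI exI)
  show "pverts (complete_bipartite_graph a b) = {..<a} \<union> {a..<a + b}"
    by (auto simp: complete_bipartite_graph_def)
qed (auto simp: complete_bipartite_graph_def)

lemma pair_graph_complete_bipartite_graph: "pair_graph (complete_bipartite_graph a b)"
  using complete_bipartite_graph by (rule pair_graphI_complete_bipartite)

definition num_neg_eigenvalues :: "real mat \<Rightarrow> nat" where
  "num_neg_eigenvalues M = size {#x \<in># proots (char_poly M). x < 0#}"

definition \<M> :: "nat pair_pre_digraph \<Rightarrow> real mat set" where
  "\<M> G = {M. square_mat M \<and> pverts G = {..<dim_row M} \<and> transpose_mat M = M \<and>
     (\<forall>u \<in> pverts G. \<forall>v \<in> pverts G.
        ((u, v) \<in> parcs G \<longrightarrow> M $$ (u, v) < 0) \<and>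
        ((u, v) \<notin> parcs G \<and> u \<noteq> v \<longrightarrow> M $$ (u, v) = 0)) \<and>
     num_neg_eigenvalues M = 1}"

definition corank :: "real mat \<Rightarrow> nat" where
  "corank M = kernel_dim M"

definition strong_arnold_property :: "nat pair_pre_digraph \<Rightarrow> real mat \<Rightarrow> bool" where
  "strong_arnold_property G M \<longleftrightarrow>
     (let n = dim_row M in
      \<not> (\<exists>X \<in> carrier_mat n n. X \<noteq> 0\<^sub>m n n \<and> transpose_mat X = X \<and> M * X = 0\<^sub>m n n \<and>
           (\<forall>u \<in> pverts G. \<forall>v \<in> pverts G. (u, v) \<in> parcs G \<or> u = v \<longrightarrow> X $$ (u, v) = 0)))"

end

theory Submission
  imports Defs
begin

text \<open>
  Let \<open>J\<close> be the all-ones matrix and consider \<open>M = [[D\<^sub>1, -J], [-J\<^sup>T, D\<^sub>2]]\<close>, where \<open>D\<^sub>1\<close> and \<open>D\<^sub>2\<close>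
  are diagonal with entries 0 and 1, with exactly two zeros in \<open>D\<^sub>1\<close> and four zeros in \<open>D\<^sub>2\<close>.

  The quadratic form of \<open>M\<close> is positive semidefinite on the hyperplane where the coordinates of
  the first part sum to 0, so at most one eigenvalue can be negative. To count algebraic
  multiplicities in the characteristic polynomial, this is made explicit: \<open>M\<close> is a rank-two
  perturbation of a diagonal matrix, whence for \<open>x < 0\<close>
  \<open>det (x I - M) = (\<Prod>i. x - d\<^sub>i) (1 - f(x) g(x))\<close>, where \<open>f\<close> and \<open>g\<close> are the sums of \<open>1 / (x - d\<^sub>i)\<close>
  over the two parts (\<open>poly_char_poly_bipartite_mat\<close>). Both \<open>f\<close> and \<open>g\<close> are negative with
  negative derivative, so the last factor is strictly decreasing; it changes sign, and its only
  zero is a simple root (\<open>num_neg_eigenvalues_bipartite_mat\<close>).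

  A vector is in the kernel iff it is supported on the zeros of the diagonal and its coordinates
  sum to 0 in each part. This gives dimension \<open>1 + 3 = 4\<close>.

  Finally, write \<open>0, 1, 2, 3\<close> for the zeros of \<open>D\<^sub>2\<close>. The vectors \<open>x = e\<^sub>0 - e\<^sub>3\<close> and
  \<open>y = e\<^sub>1 - e\<^sub>2\<close> lie in the kernel and have disjoint supports in the same part, so
  \<open>X = x y\<^sup>T + y x\<^sup>T\<close> vanishes on the diagonal and on the edges, while \<open>M X = 0\<close>
  (\<open>not_strong_arnold_property_if_disjoint_supports\<close>).
\<close>

section \<open>Determinants and kernels\<close>

text \<open>
  Multiplying \<open>[[1, B], [C, 1]]\<close> by the unipotent matrix \<open>[[1, 0], [-C, 1]]\<close> from the left or from
  the right makes it block triangular with one of the two matrices in the corner. The use is for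
  \<open>k\<close> much smaller than \<open>n\<close>: it evaluates the determinant of a low-rank perturbation.
\<close>

lemma det_one_minus_mult_commute:
  fixes B C :: "'a :: idom mat"
  assumes B: "B \<in> carrier_mat k n" and C: "C \<in> carrier_mat n k"
  shows "det (1\<^sub>m k - B * C) = det (1\<^sub>m n - C * B)"
proof -
  let ?L = "four_block_mat (1\<^sub>m k) (0\<^sub>m k n) (- C) (1\<^sub>m n)"
  let ?X = "four_block_mat (1\<^sub>m k) B C (1\<^sub>m n)"
  have L: "?L \<in> carrier_mat (k + n) (k + n)" and X: "?X \<in> carrier_mat (k + n) (k + n)"
    using B C by auto
  have detL: "det ?L = 1"
    using det_four_block_mat_upper_right_zero[of "1\<^sub>m k" k "0\<^sub>m k n" n "- C" "1\<^sub>m n"] C by simp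
  have c: "1\<^sub>m n - C * B \<in> carrier_mat n n" "1\<^sub>m k - B * C \<in> carrier_mat k k"
    using B C by auto
  have blocks1: "1\<^sub>m k * 1\<^sub>m k + 0\<^sub>m k n * C = 1\<^sub>m k" "1\<^sub>m k * B + 0\<^sub>m k n * 1\<^sub>m n = B"
    "- C * 1\<^sub>m k + 1\<^sub>m n * C = 0\<^sub>m n k" "- C * B + 1\<^sub>m n * 1\<^sub>m n = 1\<^sub>m n - C * B"
    using B C by (auto intro!: eq_matI)
  have blocks2: "1\<^sub>m k * 1\<^sub>m k + B * - C = 1\<^sub>m k - B * C" "1\<^sub>m k * 0\<^sub>m k n + B * 1\<^sub>m n = B"
    "C * 1\<^sub>m k + 1\<^sub>m n * - C = 0\<^sub>m n k" "C * 0\<^sub>m k n + 1\<^sub>m n * 1\<^sub>m n = 1\<^sub>m n"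
    using B C by (auto intro!: eq_matI)
  have "?L * ?X = four_block_mat (1\<^sub>m k) B (0\<^sub>m n k) (1\<^sub>m n - C * B)"
    using mult_four_block_mat[of "1\<^sub>m k" k k "0\<^sub>m k n" n "- C" n "1\<^sub>m n" "1\<^sub>m k" k B n C "1\<^sub>m n"] B C
    by (simp only: blocks1 one_carrier_mat zero_carrier_mat uminus_carrier_mat)
  then have 1: "det ?L * det ?X = det (1\<^sub>m n - C * B)"
    using B c det_mult[OF L X]
      det_four_block_mat_lower_left_zero[of "1\<^sub>m k" k B n "0\<^sub>m n k" "1\<^sub>m n - C * B"] by simp
  have "?X * ?L = four_block_mat (1\<^sub>m k - B * C) B (0\<^sub>m n k) (1\<^sub>m n)"
    using mult_four_block_mat[of "1\<^sub>m k" k k B n C n "1\<^sub>m n" "1\<^sub>m k" k "0\<^sub>m k n" n "- C" "1\<^sub>m n"] B C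
    by (simp only: blocks2 one_carrier_mat zero_carrier_mat uminus_carrier_mat)
  then have 2: "det ?X * det ?L = det (1\<^sub>m k - B * C)"
    using B c det_mult[OF X L]
      det_four_block_mat_lower_left_zero[of "1\<^sub>m k - B * C" k B n "0\<^sub>m n k" "1\<^sub>m n"] by simp
  from 1 2 show ?thesis by (simp add: detL)
qed

lemma det_2x2:
  fixes A :: "'a :: idom mat"
  assumes "A \<in> carrier_mat 2 2"
  shows "det A = A $$ (0,0) * A $$ (1,1) - A $$ (0,1) * A $$ (1,0)"
proof -
  have "det A = (\<Sum>j<2. A $$ (0,j) * cofactor A 0 j)"
    by (rule laplace_expansion_row[OF assms]) simp
  also have "\<dots> = A $$ (0,0) * cofactor A 0 0 + A $$ (0,1) * cofactor A 0 1"
    by (simp add: numeral_2_eq_2)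
  also have "cofactor A 0 0 = A $$ (1,1)"
    using assms by (simp add: cofactor_def mat_delete_def det_single)
  also have "cofactor A 0 1 = - A $$ (1,0)"
    using assms by (simp add: cofactor_def mat_delete_def det_single)
  finally show ?thesis by simp
qed

text \<open>
  The coordinates in \<open>S\<close> identify the kernel with the space of functions on \<open>S\<close>: the vectors \<open>v s\<close>
  are mapped to the standard basis, and injectivity is the assumption \<open>determined\<close>.
\<close>

lemma kernel_dim_eq_card_coordinates:
  fixes A :: "'a :: field mat" and v :: "nat \<Rightarrow> 'a vec"
  assumes A: "A \<in> carrier_mat nr nc" and S: "S \<subseteq> {..<nc}"
    and v: "\<And>s. s \<in> S \<Longrightarrow> v s \<in> mat_kernel A"
    and dual: "\<And>s t. s \<in> S \<Longrightarrow> t \<in> S \<Longrightarrow> v s $ t = (if s = t then 1 else 0)"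
    and determined: "\<And>k. k \<in> mat_kernel A \<Longrightarrow> (\<And>s. s \<in> S \<Longrightarrow> k $ s = 0) \<Longrightarrow> k = 0\<^sub>v nc"
  shows "kernel_dim A = card S"
proof -
  interpret kernel nr nc A by unfold_locales (rule A)
  let ?B = "v ` S"
  have fin: "finite S" using S finite_subset by blast
  have sub: "?B \<subseteq> mat_kernel A" using v by auto
  have inj: "inj_on v S"
    using dual by (intro inj_onI) (metis zero_neq_one)
  have coord: "lincomb c ?B $ t = c (v t)" if "t \<in> S" for c t
  proof -
    have "lincomb c ?B $ t = (\<Sum>x\<in>?B. c x * x $ t)"
      using S that sub by (intro lincomb_index) auto
    also have "\<dots> = (\<Sum>s\<in>S. c (v s) * v s $ t)"
      using inj by (simp add: sum.reindex)
    also have "\<dots> = (\<Sum>s\<in>S. if s = t then c (v t) else 0)"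
      using that dual by (intro sum.cong) auto
    also have "\<dots> = c (v t)" using fin that by simp
    finally show ?thesis .
  qed
  have "basis ?B"
    unfolding Ker.basis_def
  proof (intro conjI)
    show "?B \<subseteq> mat_kernel A" by (rule sub)
    show "\<not> lin_dep ?B"
    proof (rule Ker.finite_lin_indpt2)
      show "finite ?B" "?B \<subseteq> mat_kernel A" using fin sub by auto
      fix c assume "lincomb c ?B = 0\<^sub>v nc"
      then show "\<forall>x\<in>?B. c x = 0"
        using coord S by (metis (no_types, lifting) imageE index_zero_vec(1) lessThan_iff subsetD)
    qed
    show "span ?B = mat_kernel A"
    proof
      show "span ?B \<subseteq> mat_kernel A" using sub by (rule Ker.span_is_subset2)
      show "mat_kernel A \<subseteq> span ?B"
      proof
        fix k assume k: "k \<in> mat_kernel A"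
        define c where "c x = k $ (the_inv_into S v x)" for x
        have c: "c (v s) = k $ s" if "s \<in> S" for s
          using that inj by (simp add: c_def the_inv_into_f_f)
        let ?l = "lincomb c ?B"
        have l: "?l \<in> span ?B"
          using fin sub by (auto simp: Ker.finite_span)
        then have lk: "?l \<in> mat_kernel A" using sub Ker.span_is_subset2 by blast
        note kD = mat_kernelD[OF A k] and lD = mat_kernelD[OF A lk]
        have "k - ?l \<in> mat_kernel A"
          using kD lD A by (intro mat_kernelI[OF A]) (auto simp: mult_minus_distrib_mat_vec)
        moreover have "(k - ?l) $ s = 0" if "s \<in> S" for s
          using that S kD(1) lD(1) coord c by auto
        ultimately have 0: "k - ?l = 0\<^sub>v nc" by (rule determined)
        have "k = ?l"
        proof (rule eq_vecI)
          fix i assume "i < dim_vec ?l"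
          then show "k $ i = ?l $ i"
            using arg_cong[OF 0, of "\<lambda>w. w $ i"] kD(1) lD(1) by auto
        qed (use kD lD in auto)
        then show "k \<in> span ?B" using l by simp
      qed
    qed
  qed
  then have "dim = card ?B" using fin by (intro Ker.dim_basis) auto
  then show ?thesis using inj by (simp add: card_image)
qed

section \<open>Polynomials with one simple negative root\<close>

text \<open>
  A decreasing function has at most one zero, and since its derivative does not vanish there, the
  product rule shows that the corresponding root of \<open>p\<close> is simple. This counts multiplicities
  using the values of \<open>p\<close> on the negative half-line alone.
\<close>

lemma one_simple_negative_root:
  fixes p q :: "real poly" and h h' :: "real \<Rightarrow> real"
  assumes factor: "\<And>x. x < 0 \<Longrightarrow> poly p x = poly q x * h x"
    and q: "\<And>x. x < 0 \<Longrightarrow> poly q x \<noteq> 0"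
    and deriv: "\<And>x. x < 0 \<Longrightarrow> (h has_real_derivative h' x) (at x)"
    and decr: "\<And>x. x < 0 \<Longrightarrow> h' x < 0"
    and signs: "s < t" "t < 0" "h s > 0" "h t < 0"
  shows "size {#x \<in># proots p. x < 0#} = 1"
proof -
  have mono: "h y < h x" if "x < y" "y < 0" for x y
    using that by (intro DERIV_neg_imp_decreasing[of x y h]) (auto intro!: exI deriv decr)
  have "\<exists>x\<ge>s. x \<le> t \<and> h x = 0"
  proof (rule IVT2)
    show "\<forall>x. s \<le> x \<and> x \<le> t \<longrightarrow> isCont h x"
      using signs(2) by (auto intro: DERIV_isCont[OF deriv])
  qed (use signs in auto)
  then obtain r where "r \<le> t" "h r = 0" by blast
  then have r: "r < 0" "h r = 0" using signs(2) by auto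
  have uniq: "x = r" if "x < 0" "h x = 0" for x
  proof (rule ccontr)
    assume "x \<noteq> r"
    then consider "x < r" | "r < x" by linarith
    then show False using mono[of x r] mono[of r x] that r by cases simp_all
  qed
  have roots: "poly p x = 0 \<longleftrightarrow> x = r" if "x < 0" for x
    using factor[OF that] q[OF that] uniq[OF that] r(2) by auto
  have "poly p t \<noteq> 0" using factor[of t] q[of t] signs by auto
  then have p0: "p \<noteq> 0" by auto
  have D: "((\<lambda>x. poly q x * h x) has_real_derivative poly q r * h' r) (at r)"
    using DERIV_mult[OF poly_DERIV[of q r] deriv[OF r(1)]] r(2) by (simp add: mult.commute)
  have "(poly p has_real_derivative poly q r * h' r) (at r)"
  proof (rule has_field_derivative_transform_within_open[OF D])
    show "open {..<0::real}" "r \<in> {..<0}" using r by auto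
  qed (simp add: factor)
  then have "poly (pderiv p) r = poly q r * h' r"
    using poly_DERIV DERIV_unique by blast
  then have pd: "poly (pderiv p) r \<noteq> 0" using q[of r] decr[of r] r by auto
  then have "Polynomial.order r p = Suc (Polynomial.order r (pderiv p))"
    using p0 roots[of r] r by (intro order_pderiv) (auto simp: order_root)
  then have ord: "Polynomial.order r p = 1" using pd by (simp add: order_0I)
  have "{#x \<in># proots p. x < 0#} = {#r#}"
  proof (rule multiset_eqI)
    fix x
    show "count {#x \<in># proots p. x < 0#} x = count {#r#} x"
      using p0 r(1) ord roots[of x] order_0I[of p x] by auto
  qed
  then show ?thesis by simp
qed

section \<open>The complete bipartite graph with arbitrary diagonal\<close>

definition bipartite_mat :: "nat \<Rightarrow> nat \<Rightarrow> (nat \<Rightarrow> real) \<Rightarrow> real mat" where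
  "bipartite_mat a b d =
     mat (a + b) (a + b) (\<lambda>(i,j). if i = j then d i else if (i < a) = (j < a) then 0 else -1)"

lemma bipartite_mat_carrier [simp]: "bipartite_mat a b d \<in> carrier_mat (a + b) (a + b)"
  by (simp add: bipartite_mat_def)

text \<open>
  Let \<open>u\<close> and \<open>w\<close> be the indicator vectors of the two parts. Then \<open>x I - M = D + u w\<^sup>T + w u\<^sup>T\<close> with
  \<open>D\<close> diagonal and invertible, and this is \<open>D (1 - C B)\<close> with \<open>C = - D\<^sup>-\<^sup>1 [u w]\<close> and with \<open>B\<close> having rows
  \<open>w\<^sup>T\<close> and \<open>u\<^sup>T\<close>. The product \<open>B C\<close> is only 2 by 2 and, as the parts are disjoint, has zero diagonal.
\<close>

lemma poly_char_poly_bipartite_mat: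
  assumes nz: "\<And>i. i < a + b \<Longrightarrow> x \<noteq> d i"
  shows "poly (char_poly (bipartite_mat a b d)) x =
    (\<Prod>i<a+b. x - d i) * (1 - (\<Sum>i<a. 1 / (x - d i)) * (\<Sum>i=a..<a+b. 1 / (x - d i)))"
proof -
  define n where "n = a + b"
  define D where "D = mat n n (\<lambda>(i,j). if i = j then x - d i else 0)"
  define C where "C = mat n 2 (\<lambda>(i,k). if (i < a) = (k = 0) then - 1 / (x - d i) else 0)"
  define B where "B = mat 2 n (\<lambda>(k,j). if (j < a) = (k = 1) then 1 else (0::real))"
  have carr: "D \<in> carrier_mat n n" "C \<in> carrier_mat n 2" "B \<in> carrier_mat 2 n"
    by (simp_all add: D_def C_def B_def)
  have E: "1\<^sub>m n - C * B \<in> carrier_mat n n"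
    using carr(2,3) by (metis minus_carrier_mat mult_carrier_mat)
  have CB: "(C * B) $$ (i,j) = (if (i < a) = (j < a) then 0 else - 1 / (x - d i))"
    if "i < n" "j < n" for i j
    using that by (auto simp: C_def B_def scalar_prod_def numeral_2_eq_2)
  have fac: "- char_matrix (bipartite_mat a b d) x = D * (1\<^sub>m n - C * B)"
  proof (rule eq_matI)
    fix i j assume "i < dim_row (D * (1\<^sub>m n - C * B))" "j < dim_col (D * (1\<^sub>m n - C * B))"
    then have ij: "i < n" "j < n" using carr by auto
    have "(D * E) $$ (i,j) = (\<Sum>k<n. if k = i then (x - d i) * E $$ (i,j) else 0)"
      if "E \<in> carrier_mat n n" for E
    proof -
      have "(D * E) $$ (i,j) = (\<Sum>k<n. D $$ (i,k) * E $$ (k,j))"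
        using ij that carr(1) by (simp add: scalar_prod_def atLeast0LessThan)
      also have "\<dots> = (\<Sum>k<n. if k = i then (x - d i) * E $$ (i,j) else 0)"
        using ij by (intro sum.cong) (auto simp: D_def)
      finally show ?thesis .
    qed
    from this[OF E] have "(D * (1\<^sub>m n - C * B)) $$ (i,j) =
        (\<Sum>k<n. if k = i then (x - d i) * (1\<^sub>m n - C * B) $$ (i,j) else 0)" .
    also have "\<dots> = (x - d i) * (1\<^sub>m n - C * B) $$ (i,j)" using ij by simp
    also have "(1\<^sub>m n - C * B) $$ (i,j) =
        (if i = j then 1 else 0) - (if (i < a) = (j < a) then 0 else - 1 / (x - d i))"
      using ij carr CB[OF ij] by simp
    also have "(x - d i) * \<dots> = (- char_matrix (bipartite_mat a b d) x) $$ (i,j)"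
      using ij nz[of i] by (auto simp: char_matrix_def bipartite_mat_def n_def)
    finally show "(- char_matrix (bipartite_mat a b d) x) $$ (i,j) = (D * (1\<^sub>m n - C * B)) $$ (i,j)" ..
  qed (use carr in \<open>auto simp: char_matrix_def bipartite_mat_def n_def\<close>)
  have "det D = (\<Prod>i<n. x - d i)"
  proof -
    have "diag_mat D = map (\<lambda>i. x - d i) [0..<n]" by (simp add: D_def diag_mat_def)
    moreover have "upper_triangular D" by (auto simp: D_def)
    ultimately show ?thesis
      using det_upper_triangular[OF _ carr(1)]
        prod.distinct_set_conv_list[of "[0..<n]" "\<lambda>i. x - d i"] by (simp add: atLeast0LessThan)
  qed
  moreover have "det (1\<^sub>m n - C * B) =
      1 - (\<Sum>i<a. 1 / (x - d i)) * (\<Sum>i=a..<a+b. 1 / (x - d i))"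
  proof -
    have split: "{0..<n} = {..<a} \<union> {a..<a+b}" "{..<a} \<inter> {a..<a+b} = {}"
      by (auto simp: n_def)
    have "(B * C) $$ (k,l) =
        (\<Sum>i<a. B $$ (k,i) * C $$ (i,l)) + (\<Sum>i=a..<a+b. B $$ (k,i) * C $$ (i,l))"
      if "k < 2" "l < 2" for k l
    proof -
      have "(B * C) $$ (k,l) = (\<Sum>i\<in>{0..<n}. B $$ (k,i) * C $$ (i,l))"
        using that carr by (simp add: scalar_prod_def)
      then show ?thesis by (simp add: split(1) sum.union_disjoint[OF _ _ split(2)])
    qed
    note BC = this
    have "B $$ (k,i) * C $$ (i,l) =
        (if k = (if i < a then 1 else 0) \<and> l = (if i < a then 0 else 1) then - (1 / (x - d i)) else 0)"
      if "k < 2" "l < 2" "i < n" for k l i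
      using that by (auto simp: B_def C_def)
    then have "(B * C) $$ (0,0) = 0" "(B * C) $$ (1,1) = 0"
      "(B * C) $$ (0,1) = - (\<Sum>i=a..<a+b. 1 / (x - d i))"
      "(B * C) $$ (1,0) = - (\<Sum>i<a. 1 / (x - d i))"
      by (simp_all add: BC n_def sum_negf)
    then have "det (1\<^sub>m 2 - B * C) =
      1 - (\<Sum>i<a. 1 / (x - d i)) * (\<Sum>i=a..<a+b. 1 / (x - d i))"
      using carr by (subst det_2x2) auto
    then show ?thesis using det_one_minus_mult_commute[OF carr(3,2)] by simp
  qed
  moreover have "poly (char_poly (bipartite_mat a b d)) x = det D * det (1\<^sub>m n - C * B)"
    unfolding char_poly_matrix[OF bipartite_mat_carrier] fac
    by (rule det_mult[OF carr(1) E])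
  ultimately show ?thesis by (simp add: n_def)
qed

text \<open>
  A zero on the diagonal in each part makes \<open>f\<close> and \<open>g\<close> unbounded near 0, so that \<open>1 - f g\<close> is negative
  there, while \<open>f g\<close> tends to 0 at \<open>-\<infinity>\<close>. Below, \<open>R I\<close> is the sum over \<open>I\<close>, so \<open>f\<close> and \<open>g\<close> are its
  instances at the two parts, and \<open>R' I\<close> is its derivative.
\<close>

lemma num_neg_eigenvalues_bipartite_mat:
  assumes d: "\<And>i. i < a + b \<Longrightarrow> d i \<ge> 0"
    and ij: "i < a" "d i = 0" "a \<le> j" "j < a + b" "d j = 0"
  shows "num_neg_eigenvalues (bipartite_mat a b d) = 1"
proof -
  define R where "R I x = (\<Sum>i\<in>I. 1 / (x - d i))" for I and x :: real
  define R' where "R' I x = (\<Sum>i\<in>I. - 1 / (x - d i)\<^sup>2)" for I and x :: real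
  let ?A = "{..<a}" and ?B = "{a..<a+b}"
  have neg: "x - d i < 0" if "x < 0" "i < a + b" for x i using d[of i] that by auto
  have DR: "(R I has_real_derivative R' I x) (at x)" if "x < 0" "I \<subseteq> {..<a+b}" for I x
  proof -
    have "x - d i \<noteq> 0" if "i \<in> I" for i using neg[of x i] that \<open>x < 0\<close> \<open>I \<subseteq> _\<close> by auto
    then show ?thesis unfolding R_def [abs_def] R'_def
      by (auto intro!: derivative_eq_intros simp: power2_eq_square sum_divide_distrib)
  qed
  have Rneg: "R I x < 0" and R'neg: "R' I x < 0"
    if "x < 0" "I \<subseteq> {..<a+b}" "I \<noteq> {}" for I x
  proof -
    have fin: "finite I" using that finite_subset by blast
    have n: "x - d i < 0" if "i \<in> I" for i using neg[of x i] that \<open>x < 0\<close> \<open>I \<subseteq> _\<close> by auto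
    have "(\<Sum>i\<in>I. - (1 / (x - d i))) > 0"
    proof (rule sum_pos[OF fin that(3)])
      fix i assume "i \<in> I"
      from n[OF this] show "0 < - (1 / (x - d i))" by (simp add: divide_less_0_iff)
    qed
    moreover have "(\<Sum>i\<in>I. 1 / (x - d i)\<^sup>2) > 0"
    proof (rule sum_pos[OF fin that(3)])
      fix i assume "i \<in> I"
      from n[OF this] show "0 < 1 / (x - d i)\<^sup>2" by simp
    qed
    ultimately
    show "R I x < 0" "R' I x < 0"
      by (simp_all add: R_def R'_def sum_negf)
  qed
  have sub: "?A \<subseteq> {..<a+b}" "?A \<noteq> {}" "?B \<subseteq> {..<a+b}" "?B \<noteq> {}"
    using ij by auto
  have lower: "- R I x \<ge> 1 / - x" if "x < 0" "I \<subseteq> {..<a+b}" "k \<in> I" "d k = 0" for I x k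
  proof -
    have "finite I" using that finite_subset by blast
    moreover have "x - d i < 0" if "i \<in> I" for i using neg[of x i] that \<open>x < 0\<close> \<open>I \<subseteq> _\<close> by auto
    ultimately have "- 1 / (x - d k) \<le> (\<Sum>i\<in>I. - 1 / (x - d i))"
      using that(3) by (intro member_le_sum) (auto simp: divide_nonpos_neg less_imp_le)
    then show ?thesis using that(4) by (simp add: R_def sum_negf)
  qed
  have upper: "- R I x \<le> real (card I) / - x" if "x < 0" "I \<subseteq> {..<a+b}" for I x
  proof -
    have "- R I x = (\<Sum>i\<in>I. 1 / (d i - x))"
      by (simp add: R_def sum_negf[symmetric] minus_divide_right del: divide_minus_right)
    also have "\<dots> \<le> (\<Sum>i\<in>I. 1 / - x)"
      using that d by (intro sum_mono divide_left_mono mult_pos_pos) (auto, smt (verit) lessThan_iff subsetD)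
    finally show ?thesis by simp
  qed
  let ?q = "\<Prod>i<a+b. [:- d i, 1:]"
  let ?h = "\<lambda>x. 1 - R ?A x * R ?B x"
  let ?h' = "\<lambda>x. - (R' ?A x * R ?B x + R' ?B x * R ?A x)"
  have "size {#x \<in># proots (char_poly (bipartite_mat a b d)). x < 0#} = 1"
  proof (rule one_simple_negative_root[of _ ?q ?h ?h' "- real (a + b)" "-1/2"])
    fix x :: real assume x: "x < 0"
    have "x \<noteq> d i" if "i < a + b" for i using neg[OF x that] by auto
    then show "poly (char_poly (bipartite_mat a b d)) x = poly ?q x * ?h x"
      by (subst poly_char_poly_bipartite_mat) (auto simp: R_def poly_prod)
    show "poly ?q x \<noteq> 0" using neg[OF x] by (fastforce simp: poly_prod)
    show "(?h has_real_derivative ?h' x) (at x)"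
      using x sub by (auto intro!: derivative_eq_intros DR)
    show "?h' x < 0"
      using Rneg[OF x sub(1,2)] Rneg[OF x sub(3,4)] R'neg[OF x sub(1,2)] R'neg[OF x sub(3,4)]
        mult_neg_neg[of "R' ?A x" "R ?B x"] mult_neg_neg[of "R' ?B x" "R ?A x"] by linarith
  next
    \<comment> \<open>At \<open>-1/2\<close> the zero diagonal entry alone contributes 2 to the absolute value of each sum.\<close>
    have "1 < 2 * (2::real)" by simp
    also have "\<dots> \<le> (- R ?A (-1/2)) * (- R ?B (-1/2))"
      using lower[of "-1/2" ?A i] lower[of "-1/2" ?B j] ij sub(1,3) by (intro mult_mono) auto
    finally show "?h (-1/2) < 0" by simp
    \<comment> \<open>At \<open>-(a + b)\<close> every summand is at most \<open>1 / (a + b)\<close> in absolute value, so both sums are below 1.\<close>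
    have le: "- R I (- real (a + b)) \<le> card I / (a + b)" "- R I (- real (a + b)) > 0"
      if "I \<subseteq> {..<a+b}" "I \<noteq> {}" for I
      using upper[of "- real (a + b)" I] Rneg[of "- real (a + b)" I] that ij by (simp_all add: add.commute)
    have "(- R ?A (- real (a + b))) * (- R ?B (- real (a + b))) \<le> (a / (a + b)) * (b / (a + b))"
      using le[of ?A] le[of ?B] sub by (intro mult_mono) auto
    also have "\<dots> < 1 * 1"
      using ij by (intro mult_strict_mono) auto
    finally show "?h (- real (a + b)) > 0" by simp
  qed (use ij in auto)
  then show ?thesis by (simp add: num_neg_eigenvalues_def)
qed

lemma bipartite_mat_in_\<M>:
  assumes "num_neg_eigenvalues (bipartite_mat a b d) = 1"
  shows "bipartite_mat a b d \<in> \<M> (complete_bipartite_graph a b)"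
  unfolding \<M>_def
proof (intro CollectI conjI)
  show "transpose_mat (bipartite_mat a b d) = bipartite_mat a b d"
    by (auto simp: bipartite_mat_def intro!: eq_matI)
qed (use assms in \<open>auto simp: bipartite_mat_def complete_bipartite_graph_def\<close>)

lemma bipartite_mat_mult_vec:
  assumes "k \<in> carrier_vec (a + b)" "i < a + b"
  shows "(bipartite_mat a b d *\<^sub>v k) $ i =
    d i * k $ i - (if i < a then \<Sum>j=a..<a+b. k $ j else \<Sum>j<a. k $ j)"
proof -
  have split: "{0..<a+b} = {..<a} \<union> {a..<a+b}" by auto
  have e: "(bipartite_mat a b d *\<^sub>v k) $ i =
      (\<Sum>j\<in>{0..<a+b}. (if j = i then d i * k $ i else 0) -
        (if (i < a) = (j < a) then 0 else k $ j))"
    using assms by (auto simp: bipartite_mat_def mult_mat_vec_def scalar_prod_def intro!: sum.cong)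
  also have "\<dots> = d i * k $ i - (\<Sum>j\<in>{0..<a+b}. if (i < a) = (j < a) then 0 else k $ j)"
    using assms by (simp add: sum_subtractf)
  also have "(\<Sum>j\<in>{0..<a+b}. if (i < a) = (j < a) then 0 else k $ j) =
      (\<Sum>j<a. if i < a then 0 else k $ j) + (\<Sum>j=a..<a+b. if i < a then k $ j else 0)"
    unfolding split by (subst sum.union_disjoint) (auto intro!: arg_cong2[of _ _ _ _ "(+)"] sum.cong)
  finally show ?thesis by (simp split: if_splits)
qed

section \<open>The kernel and the Strong Arnold Property\<close>

definition unit_vec_diff :: "nat \<Rightarrow> nat \<Rightarrow> nat \<Rightarrow> real vec" where
  "unit_vec_diff n s t = unit_vec n s - unit_vec n t"

lemma unit_vec_diff_in_kernel:
  assumes st: "s < a + b" "t < a + b" "(s < a) = (t < a)" "d s = 0" "d t = 0"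
  shows "unit_vec_diff (a + b) s t \<in> mat_kernel (bipartite_mat a b d)"
proof (rule mat_kernelI[OF bipartite_mat_carrier])
  let ?k = "unit_vec_diff (a + b) s t"
  show carr: "?k \<in> carrier_vec (a + b)" by (simp add: unit_vec_diff_def)
  have k: "?k $ i = (if i = s then 1 else 0) - (if i = t then 1 else 0)" if "i < a + b" for i
    using that st by (simp add: unit_vec_diff_def)
  have sums: "(\<Sum>j=a..<a+b. ?k $ j) = 0" "(\<Sum>j<a. ?k $ j) = 0"
    using st by (auto simp: k sum_subtractf)
  show "bipartite_mat a b d *\<^sub>v ?k = 0\<^sub>v (a + b)"
  proof (rule eq_vecI)
    fix i assume "i < dim_vec (0\<^sub>v (a + b) :: real vec)"
    then have i: "i < a + b" by simp
    show "(bipartite_mat a b d *\<^sub>v ?k) $ i = 0\<^sub>v (a + b) $ i"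
      unfolding bipartite_mat_mult_vec[OF carr i] using i st by (cases "i < a") (simp_all add: sums, auto simp: k)
  qed (simp add: bipartite_mat_def)
qed

text \<open>
  The witness is \<open>X = x y\<^sup>T + y x\<^sup>T\<close>: its columns are combinations of \<open>x\<close> and \<open>y\<close>, hence lie in the
  kernel, and its nonzero entries are at pairs joining the two supports.
\<close>

lemma not_strong_arnold_property_if_disjoint_supports:
  fixes M :: "real mat"
  assumes M: "M \<in> carrier_mat n n" and verts: "pverts G = {..<n}"
    and ker: "x \<in> mat_kernel M" "y \<in> mat_kernel M" and nz: "x \<noteq> 0\<^sub>v n" "y \<noteq> 0\<^sub>v n"
    and supp: "\<And>u v. u < n \<Longrightarrow> v < n \<Longrightarrow> x $ u \<noteq> 0 \<Longrightarrow> y $ v \<noteq> 0 \<Longrightarrow>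
      u \<noteq> v \<and> (u, v) \<notin> parcs G \<and> (v, u) \<notin> parcs G"
  shows "\<not> strong_arnold_property G M"
proof -
  define X where "X = mat n n (\<lambda>(i,j). x $ i * y $ j + y $ i * x $ j)"
  have X: "X \<in> carrier_mat n n" by (simp add: X_def)
  note xD = mat_kernelD[OF M ker(1)] and yD = mat_kernelD[OF M ker(2)]
  obtain u where u: "u < n" "x $ u \<noteq> 0" using nz(1) xD(1) by (auto simp: vec_eq_iff)
  obtain v where v: "v < n" "y $ v \<noteq> 0" using nz(2) yD(1) by (auto simp: vec_eq_iff)
  have "y $ u = 0" using supp[of u u] u by auto
  then have "X $$ (u,v) \<noteq> 0" using u v by (simp add: X_def)
  then have "X \<noteq> 0\<^sub>m n n" using u v by auto
  moreover have "transpose_mat X = X" by (auto simp: X_def intro!: eq_matI)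
  moreover have "M * X = 0\<^sub>m n n"
  proof (rule eq_matI)
    fix i j assume "i < dim_row (0\<^sub>m n n :: real mat)" "j < dim_col (0\<^sub>m n n :: real mat)"
    then have ij: "i < n" "j < n" by auto
    have z: "(\<Sum>k\<in>{0..<n}. M $$ (i,k) * x $ k) = 0" "(\<Sum>k\<in>{0..<n}. M $$ (i,k) * y $ k) = 0"
      using arg_cong[OF xD(2), of "\<lambda>w. w $ i"] arg_cong[OF yD(2), of "\<lambda>w. w $ i"] ij M xD(1) yD(1)
      by (auto simp: scalar_prod_def)
    have "(M * X) $$ (i,j) = (\<Sum>k\<in>{0..<n}. M $$ (i,k) * x $ k) * y $ j + (\<Sum>k\<in>{0..<n}. M $$ (i,k) * y $ k) * x $ j"
      using ij M by (simp add: X_def scalar_prod_def sum_distrib_left algebra_simps sum.distrib)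
    then show "(M * X) $$ (i,j) = 0\<^sub>m n n $$ (i,j)" using z ij by simp
  qed (use M X in auto)
  moreover have "\<forall>u\<in>pverts G. \<forall>v\<in>pverts G. (u,v) \<in> parcs G \<or> u = v \<longrightarrow> X $$ (u,v) = 0"
  proof (intro ballI impI)
    fix u v assume uv: "u \<in> pverts G" "v \<in> pverts G" "(u,v) \<in> parcs G \<or> u = v"
    then have "x $ u = 0 \<or> y $ v = 0" "x $ v = 0 \<or> y $ u = 0"
      using supp[of u v] supp[of v u] by (auto simp: verts)
    then show "X $$ (u,v) = 0" using uv by (auto simp: verts X_def)
  qed
  ultimately show ?thesis
    using X M unfolding strong_arnold_property_def Let_def by auto
qed

section \<open>The matrix of corank four\<close>

theorem mainTheorem3:
  fixes a b :: nat
  assumes "a \<ge> 3" and "b \<ge> 4" and "a \<le> b"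
  shows "\<exists>M \<in> \<M> (complete_bipartite_graph a b).
           corank M = 4 \<and> \<not> strong_arnold_property (complete_bipartite_graph a b) M"
proof -
  define Z where "Z = {0, 1, a, a + 1, a + 2, a + 3}"
  define d :: "nat \<Rightarrow> real" where "d i = (if i \<in> Z then 0 else 1)" for i
  let ?n = "a + b" and ?M = "bipartite_mat a b d"
  let ?e = "unit_vec_diff (a + b)"
  have neg: "num_neg_eigenvalues ?M = 1"
    using assms by (intro num_neg_eigenvalues_bipartite_mat[of _ _ _ 0 a]) (auto simp: d_def Z_def)
  have ker: "?e s t \<in> mat_kernel ?M" if "s \<in> Z" "t \<in> Z" "(s < a) = (t < a)" for s t
    using that assms by (intro unit_vec_diff_in_kernel) (auto simp: d_def Z_def)
  \<comment> \<open>Of the six zeros of the diagonal, one in each part (0 and \<open>a\<close>) is left out: the zero-sum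
    conditions determine the coordinates there.\<close>
  have "kernel_dim ?M = card {1, a + 1, a + 2, a + 3}"
  proof (rule kernel_dim_eq_card_coordinates[OF bipartite_mat_carrier,
        where v = "\<lambda>s. ?e s (if s < a then 0 else a)"])
    fix k assume k: "k \<in> mat_kernel ?M" and 0: "\<And>s. s \<in> {1, a + 1, a + 2, a + 3} \<Longrightarrow> k $ s = 0"
    note kD = mat_kernelD[OF bipartite_mat_carrier k]
    have row: "d i * k $ i = (if i < a then \<Sum>j=a..<a+b. k $ j else \<Sum>j<a. k $ j)" if "i < ?n" for i
      using bipartite_mat_mult_vec[OF kD(1) that, of d] kD(2) that by simp
    \<comment> \<open>Rows with zero diagonal entry, one in each part, give the zero-sum conditions.\<close>
    have sums: "(\<Sum>j=a..<a+b. k $ j) = 0" "(\<Sum>j<a. k $ j) = 0"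
      using row[of 0] row[of a] assms by (auto simp: d_def Z_def)
    have rest: "k $ i = 0" if "i < ?n" "i \<noteq> 0" "i \<noteq> a" for i
      using row[OF that(1)] sums that 0 by (cases "i \<in> Z") (auto simp: d_def Z_def)
    have "(\<Sum>j<a. k $ j) = (\<Sum>j<a. if j = 0 then k $ 0 else 0)"
      using rest by (intro sum.cong) auto
    then have k0: "k $ 0 = 0" using sums assms by simp
    have "(\<Sum>j=a..<a+b. k $ j) = (\<Sum>j=a..<a+b. if j = a then k $ a else 0)"
      using rest assms by (intro sum.cong) auto
    then have ka: "k $ a = 0" using sums assms by simp
    show "k = 0\<^sub>v ?n"
    proof (rule eq_vecI)
      fix i assume "i < dim_vec (0\<^sub>v ?n :: real vec)"
      then show "k $ i = 0\<^sub>v ?n $ i" using rest[of i] k0 ka by (cases "i = 0 \<or> i = a") auto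
    qed (use kD in auto)
  next
    fix s assume "s \<in> {1, a + 1, a + 2, a + 3}"
    then show "?e s (if s < a then 0 else a) \<in> mat_kernel ?M"
      using assms by (intro ker) (auto simp: Z_def)
  qed (use assms in \<open>auto simp: unit_vec_diff_def\<close>)
  also have "\<dots> = 4" using assms by simp
  finally have cr: "corank ?M = 4" by (simp add: corank_def)
  have e: "?e s t $ i = (if i = s then 1 else 0) - (if i = t then 1 else 0)"
    if "i < ?n" "s < ?n" "t < ?n" for s t i
    using that by (simp add: unit_vec_diff_def)
  have "\<not> strong_arnold_property (complete_bipartite_graph a b) ?M"
  proof (rule not_strong_arnold_property_if_disjoint_supports[OF bipartite_mat_carrier])
    show "?e a (a + 3) \<in> mat_kernel ?M" "?e (a + 1) (a + 2) \<in> mat_kernel ?M"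
      by (intro ker; simp add: Z_def)+
    show "?e a (a + 3) \<noteq> 0\<^sub>v ?n"
      using e[of a a "a + 3"] assms by auto
    show "?e (a + 1) (a + 2) \<noteq> 0\<^sub>v ?n"
      using e[of "a + 1" "a + 1" "a + 2"] assms by auto
  qed (use assms in \<open>auto simp: e complete_bipartite_graph_def split: if_splits\<close>)
  with bipartite_mat_in_\<M>[OF neg] cr show ?thesis by blast
qed

end
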